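(* For every derivation in $\mathsf{SKS}$ with premise $T$ and conclusion $R$ there are structures $V$ and $U$ and a derivation from $T$ to $R$ composed, from top to bottom, of: a derivation from $T$ to $V$ in $\{ai{\downarrow}\}$, a derivation from $V$ to $U$ in $\mathsf{SKS}\setminus\{ai{\downarrow},ai{\uparrow}\}$, and a derivation from $U$ to $R$ in $\{ai{\uparrow}\}$.
   Context: Structures: generated by $S ::= \mathsf f \mid \mathsf t \mid a \mid [S,\dots,S] \mid (S,\dots,S) \mid \bar S$ (non-empty lists), where $a$ ranges over atoms, $\mathsf f,\mathsf t$ are the units false and true, $[\cdot]$ is disjunction, $(\cdot)$ is conjunction, $\bar S$ is negation; the negation of an atom is again an atom. A context $S\{\ \}$ is a structure with one occurrence of a hole, not in the scope of a negation; $S\{R\}$ is the result of filling it with $R$; $S[R,T]$ abbreviates $S\{[R,T]\}$ and $S(R,T)$ abbreviates $S\{(R,T)\}$. Equivalent structures are not distinguished; equivalence is the smallest equivalence relation induced by: $[\vec R,[\vec T],\vec U]=[\vec R,\vec T,\vec U]$ and $(\vec R,(\vec T),\vec U)=(\vec R,\vec T,\vec U)$ (with $\vec R,\vec T,\vec U$ finite sequences, $\vec T$ non-empty); $[R,T]=[T,R]$, $(R,T)=(T,R)$; $(\mathsf f,\mathsf f)=\mathsf f$, $[\mathsf f,R]=R$, $[\mathsf t,\mathsf t]=\mathsf t$, $(\mathsf t,R)=R$; $\bar{\mathsf f}=\mathsf t$, $\bar{\mathsf t}=\mathsf f$, $\overline{[R,T]}=(\bar R,\bar T)$, $\overline{(R,T)}=[\bar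 R,\bar T]$, $\bar{\bar R}=R$; and closure: if $R=T$ then $S\{R\}=S\{T\}$ and $\bar R=\bar T$. A derivation in a system (set of inference rules) is a finite sequence of rule instances, read top-down, the conclusion of each being the premise of the next; it may consist of a single structure. Its premise is the topmost structure, its conclusion the bottommost. System $\mathsf{SKS}$ has the rules (written $\frac{\text{premise}}{\text{conclusion}}$, for atoms $a$, structures $R,T,U,V$ and contexts $S\{\ \}$): $ai{\downarrow}:\frac{S\{\mathsf t\}}{S[a,\bar a]}$, $ai{\uparrow}:\frac{S(a,\bar a)}{S\{\mathsf f\}}$, $s:\frac{S([R,U],T)}{S[(R,T),U]}$, $m:\frac{S[(R,U),(T,V)]}{S([R,T],[U,V])}$, $aw{\downarrow}:\frac{S\{\mathsf f\}}{S\{a\}}$, $aw{\uparrow}:\frac{S\{a\}}{S\{\mathsf t\}}$, $ac{\downarrow}:\frac{S[a,a]}{S\{a\}}$, $ac{\uparrow}:\frac{S\{a\}}{S(a,a)}$. *)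

theory Defs
  imports Main
begin

text \<open>
  Structures before identification modulo equivalence.  Non-empty lists are encoded by their first
  element and the (possibly empty) list of the remaining ones, so \<open>Or R [T]\<close> is the binary
  disjunction of \<open>R\<close> and \<open>T\<close>.  \<open>'a\<close> is the type of generating atoms; see \<open>is_atom\<close> for
  the notion of atom that includes negated ones.
\<close>

datatype 'a pre_struct =
    FF
  | TT
  | Atom 'a
  | Or "'a pre_struct" "'a pre_struct list"
  | And "'a pre_struct" "'a pre_struct list"
  | Neg "'a pre_struct"

text \<open>The atoms are closed under negation: the negation of an atom is again an atom.\<close>

inductive is_atom :: "'a pre_struct \<Rightarrow> bool" where
  "is_atom (Atom x)"
| "is_atom a \<Longrightarrow> is_atom (Neg a)"

text \<open>
  The disjunction (conjunction) of the non-empty list \<open>Rs @ S # Us\<close>, where \<open>Rs\<close> and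
  \<open>Us\<close> may be empty.
\<close>

fun or_list :: "'a pre_struct list \<Rightarrow> 'a pre_struct \<Rightarrow> 'a pre_struct list \<Rightarrow> 'a pre_struct" where
  "or_list [] S Us = Or S Us"
| "or_list (R # Rs) S Us = Or R (Rs @ S # Us)"

fun and_list :: "'a pre_struct list \<Rightarrow> 'a pre_struct \<Rightarrow> 'a pre_struct list \<Rightarrow> 'a pre_struct" where
  "and_list [] S Us = And S Us"
| "and_list (R # Rs) S Us = And R (Rs @ S # Us)"

text \<open>There is no constructor for negation: the hole is not in the scope of a negation.\<close>

datatype 'a ctx =
    Hole
  | OrC "'a pre_struct list" "'a ctx" "'a pre_struct list"
  | AndC "'a pre_struct list" "'a ctx" "'a pre_struct list"

fun fill :: "'a ctx \<Rightarrow> 'a pre_struct \<Rightarrow> 'a pre_struct" where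
  "fill Hole R = R"
| "fill (OrC Rs S Us) R = or_list Rs (fill S R) Us"
| "fill (AndC Rs S Us) R = and_list Rs (fill S R) Us"

inductive struct_eq :: "'a pre_struct \<Rightarrow> 'a pre_struct \<Rightarrow> bool" where
  refl: "struct_eq R R"
| sym: "struct_eq R T \<Longrightarrow> struct_eq T R"
| trans: "struct_eq R T \<Longrightarrow> struct_eq T U \<Longrightarrow> struct_eq R U"
| or_assoc: "struct_eq (or_list Rs (Or T Ts) Us) (or_list Rs T (Ts @ Us))"
| and_assoc: "struct_eq (and_list Rs (And T Ts) Us) (and_list Rs T (Ts @ Us))"
| or_comm: "struct_eq (Or R [T]) (Or T [R])"
| and_comm: "struct_eq (And R [T]) (And T [R])"
| and_FF: "struct_eq (And FF [FF]) FF"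
| or_FF: "struct_eq (Or FF [R]) R"
| or_TT: "struct_eq (Or TT [TT]) TT"
| and_TT: "struct_eq (And TT [R]) R"
| neg_FF: "struct_eq (Neg FF) TT"
| neg_TT: "struct_eq (Neg TT) FF"
| neg_or: "struct_eq (Neg (Or R [T])) (And (Neg R) [Neg T])"
| neg_and: "struct_eq (Neg (And R [T])) (Or (Neg R) [Neg T])"
| neg_neg: "struct_eq (Neg (Neg R)) R"
| ctx_cong: "struct_eq R T \<Longrightarrow> struct_eq (fill S R) (fill S T)"
| neg_cong: "struct_eq R T \<Longrightarrow> struct_eq (Neg R) (Neg T)"

quotient_type 'a struct = "'a pre_struct" / struct_eq
  morphisms rep_struct cls
  by (intro equivpI reflpI sympI transpI) (blast intro: struct_eq.refl struct_eq.sym struct_eq.trans)+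

datatype rule =
    Ai_down | Ai_up | Switch | Medial | Aw_down | Aw_up | Ac_down | Ac_up

text \<open>\<open>rule_inst r P Q\<close>: an instance of rule \<open>r\<close> with premise \<open>P\<close> and conclusion \<open>Q\<close>.\<close>

inductive rule_inst :: "rule \<Rightarrow> 'a struct \<Rightarrow> 'a struct \<Rightarrow> bool" where
  ai_down: "is_atom a \<Longrightarrow> rule_inst Ai_down (cls (fill S TT)) (cls (fill S (Or a [Neg a])))"
| ai_up: "is_atom a \<Longrightarrow> rule_inst Ai_up (cls (fill S (And a [Neg a]))) (cls (fill S FF))"
| s: "rule_inst Switch (cls (fill S (And (Or R [U]) [T]))) (cls (fill S (Or (And R [T]) [U])))"
| m: "rule_inst Medial (cls (fill S (Or (And R [U]) [And T [V]])))
                            (cls (fill S (And (Or R [T]) [Or U [V]])))"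
| aw_down: "is_atom a \<Longrightarrow> rule_inst Aw_down (cls (fill S FF)) (cls (fill S a))"
| aw_up: "is_atom a \<Longrightarrow> rule_inst Aw_up (cls (fill S a)) (cls (fill S TT))"
| ac_down: "is_atom a \<Longrightarrow> rule_inst Ac_down (cls (fill S (Or a [a]))) (cls (fill S a))"
| ac_up: "is_atom a \<Longrightarrow> rule_inst Ac_up (cls (fill S a)) (cls (fill S (And a [a])))"

definition SKS :: "rule set" where
  "SKS = {Ai_down, Ai_up, Switch, Medial, Aw_down, Aw_up, Ac_down, Ac_up}"

text \<open>
  \<open>derivation Sys T D R\<close>: \<open>D\<close> is a derivation in \<open>Sys\<close> with premise \<open>T\<close> and
  conclusion \<open>R\<close>.  \<open>D\<close> records, from top to bottom, the rule and the conclusion of each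
  instance; the premise of an instance is the conclusion of the preceding one (\<open>T\<close> for the
  first).  Hence vertical composition of derivations is list append.
\<close>

inductive derivation ::
  "rule set \<Rightarrow> 'a struct \<Rightarrow> (rule \<times> 'a struct) list \<Rightarrow> 'a struct \<Rightarrow> bool"
  for Sys where
  single: "derivation Sys T [] T"
| step: "r \<in> Sys \<Longrightarrow> rule_inst r T Q \<Longrightarrow> derivation Sys Q D R \<Longrightarrow> derivation Sys T ((r, Q) # D) R"

end

theory Submission
  imports Defs
begin

text \<open>
  An identity instance \<open>S{t} / S[a,-a]\<close> can be simulated without identity if \<open>[a,-a]\<close> is
  available in conjunction with the premise: repeated switches move it from \<open>(S{t},[a,-a])\<close> to
  \<open>S(t,[a,-a]) = S[a,-a]\<close>. Dually, \<open>S(a,-a)\<close> yields \<open>[S{f},(a,-a)]\<close>, which postpones the cut.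
  So a derivation from \<open>T\<close> to \<open>R\<close> becomes one from \<open>(T,K)\<close> to \<open>[R,L]\<close> without identity and cut,
  where \<open>K\<close> is a conjunction of identities and \<open>L\<close> a disjunction of cuts.
\<close>

section \<open>Binary disjunction and conjunction of equivalence classes\<close>

lift_definition sor :: "'a struct \<Rightarrow> 'a struct \<Rightarrow> 'a struct" is "\<lambda>R T. Or R [T]"
proof -
  fix R R' T T' :: "'a pre_struct"
  assume "struct_eq R R'" "struct_eq T T'"
  then show "struct_eq (Or R [T]) (Or R' [T'])"
    \<comment> \<open>One argument is replaced at a time, inside a context that holds the other one
      fixed.\<close>
    using ctx_cong[of R R' "OrC [] Hole [T]"] ctx_cong[of T T' "OrC [R'] Hole []"]
    by (auto intro: struct_eq.trans)
qed

lift_definition sand :: "'a struct \<Rightarrow> 'a struct \<Rightarrow> 'a struct" is "\<lambda>R T. And R [T]"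
proof -
  fix R R' T T' :: "'a pre_struct"
  assume "struct_eq R R'" "struct_eq T T'"
  then show "struct_eq (And R [T]) (And R' [T'])"
    using ctx_cong[of R R' "AndC [] Hole [T]"] ctx_cong[of T T' "AndC [R'] Hole []"]
    by (auto intro: struct_eq.trans)
qed

lemma ex_cls: "\<exists>P. X = cls P"
  by (induction X rule: struct.abs_induct) blast

lemma sor_commute: "sor X Y = sor Y X"
  by transfer (rule struct_eq.or_comm)

lemma sand_commute: "sand X Y = sand Y X"
  by transfer (rule struct_eq.and_comm)

lemma sor_assoc: "sor (sor X Y) Z = sor X (sor Y Z)"
proof transfer
  fix X Y Z :: "'a pre_struct"
  show "struct_eq (Or (Or X [Y]) [Z]) (Or X [Or Y [Z]])"
    using or_assoc[of "[]" X "[Y]" "[Z]"] or_assoc[of "[X]" Y "[Z]" "[]"]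
    by (auto intro: struct_eq.trans struct_eq.sym)
qed

lemma sand_assoc: "sand (sand X Y) Z = sand X (sand Y Z)"
proof transfer
  fix X Y Z :: "'a pre_struct"
  show "struct_eq (And (And X [Y]) [Z]) (And X [And Y [Z]])"
    using and_assoc[of "[]" X "[Y]" "[Z]"] and_assoc[of "[X]" Y "[Z]" "[]"]
    by (auto intro: struct_eq.trans struct_eq.sym)
qed

lemma sor_FF [simp]: "sor (cls FF) X = X" "sor X (cls FF) = X"
proof -
  show "sor (cls FF) X = X"
    by transfer (rule struct_eq.or_FF)
  then show "sor X (cls FF) = X"
    by (simp add: sor_commute)
qed

lemma sand_TT [simp]: "sand (cls TT) X = X" "sand X (cls TT) = X"
proof -
  show "sand (cls TT) X = X"
    by transfer (rule struct_eq.and_TT)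
  then show "sand X (cls TT) = X"
    by (simp add: sand_commute)
qed

section \<open>Lists, contexts and rule instances in terms of the binary connectives\<close>

lemma cls_Or_assoc: "cls (or_list Rs (Or T Ts) Us) = cls (or_list Rs T (Ts @ Us))"
  by (simp add: struct.abs_eq_iff or_assoc)

lemma cls_And_assoc: "cls (and_list Rs (And T Ts) Us) = cls (and_list Rs T (Ts @ Us))"
  by (simp add: struct.abs_eq_iff and_assoc)

text \<open>A singleton disjunction \<open>[R]\<close> equals \<open>R\<close> only via the unit: \<open>[R] = [[f,R]] = [f,R] = R\<close>.\<close>

lemma cls_Or_Nil: "cls (Or R []) = cls R"
proof -
  have "struct_eq (Or R []) (Or (Or FF [R]) [])"
    using ctx_cong[OF struct_eq.sym[OF or_FF], of "OrC [] Hole []" R] by simp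
  then show ?thesis
    using cls_Or_assoc[of "[]" FF "[R]" "[]"]
    by (simp add: struct.abs_eq_iff) (meson or_FF struct_eq.trans)
qed

lemma cls_And_Nil: "cls (And R []) = cls R"
proof -
  have "struct_eq (And R []) (And (And TT [R]) [])"
    using ctx_cong[OF struct_eq.sym[OF and_TT], of "AndC [] Hole []" R] by simp
  then show ?thesis
    using cls_And_assoc[of "[]" TT "[R]" "[]"]
    by (simp add: struct.abs_eq_iff) (meson and_TT struct_eq.trans)
qed

lemma cls_Or_eq_sor: "\<exists>W. \<forall>X. cls (Or X Us) = sor (cls X) W"
proof (cases Us)
  case Nil
  then show ?thesis
    using cls_Or_Nil by (metis sor_FF(2))
next
  case (Cons U Us')
  have "cls (Or X Us) = sor (cls X) (cls (Or U Us'))" for X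
    using cls_Or_assoc[of "[X]" U Us' "[]"] Cons by (simp add: sor.abs_eq)
  then show ?thesis by blast
qed

lemma cls_And_eq_sand: "\<exists>W. \<forall>X. cls (And X Us) = sand (cls X) W"
proof (cases Us)
  case Nil
  then show ?thesis
    using cls_And_Nil by (metis sand_TT(2))
next
  case (Cons U Us')
  have "cls (And X Us) = sand (cls X) (cls (And U Us'))" for X
    using cls_And_assoc[of "[X]" U Us' "[]"] Cons by (simp add: sand.abs_eq)
  then show ?thesis by blast
qed

text \<open>The order of quantifiers matters: \<open>W\<close> is independent of \<open>X\<close>,
  so a disjunctive layer of a context acts on whatever fills it as disjunction with one fixed
  structure. Inductions on contexts thereby reduce to the binary connectives.\<close>

lemma cls_or_list_eq_sor: "\<exists>W. \<forall>X. cls (or_list Rs X Us) = sor (cls X) W"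
proof (cases Rs)
  case Nil
  then show ?thesis
    using cls_Or_eq_sor by simp
next
  case (Cons R Rs')
  obtain W where W: "\<And>X. cls (Or X Us) = sor (cls X) W"
    using cls_Or_eq_sor by metis
  \<comment> \<open>Associativity groups the list into the part before \<open>X\<close> and the part
    starting at \<open>X\<close>; \<open>W\<close> accounts for \<open>Us\<close>.\<close>
  have "cls (or_list Rs X Us) = sor (cls X) (sor W (cls (Or R Rs')))" for X
  proof -
    have "cls (or_list Rs X Us) = sor (cls (Or R Rs')) (cls (Or X Us))"
      using cls_Or_assoc[of "[]" R Rs' "X # Us"] cls_Or_assoc[of "[Or R Rs']" X Us "[]"] Cons
      by (simp add: sor.abs_eq)
    then show ?thesis
      by (metis W sor_assoc sor_commute)
  qed
  then show ?thesis by blast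
qed

lemma cls_and_list_eq_sand: "\<exists>W. \<forall>X. cls (and_list Rs X Us) = sand (cls X) W"
proof (cases Rs)
  case Nil
  then show ?thesis
    using cls_And_eq_sand by simp
next
  case (Cons R Rs')
  obtain W where W: "\<And>X. cls (And X Us) = sand (cls X) W"
    using cls_And_eq_sand by metis
  have "cls (and_list Rs X Us) = sand (cls X) (sand W (cls (And R Rs')))" for X
  proof -
    have "cls (and_list Rs X Us) = sand (cls (And R Rs')) (cls (And X Us))"
      using cls_And_assoc[of "[]" R Rs' "X # Us"] cls_And_assoc[of "[And R Rs']" X Us "[]"] Cons
      by (simp add: sand.abs_eq)
    then show ?thesis
      by (metis W sand_assoc sand_commute)
  qed
  then show ?thesis by blast
qed

text \<open>Premise and conclusion of an instance fill the same context, so it suffices that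
  \<open>f\<close> turns each context into another one, chosen independently of the filling.\<close>

lemma rule_inst_fill:
  assumes "rule_inst r P Q"
    and C: "\<And>S. \<exists>S'. \<forall>X. f (cls (fill S X)) = cls (fill S' X)"
  shows "rule_inst r (f P) (f Q)"
proof -
  obtain g where "\<And>S X. f (cls (fill S X)) = cls (fill (g S) X)"
    using C by metis
  with assms(1) show ?thesis
    by cases (simp_all add: rule_inst.intros)
qed

lemma rule_inst_sor:
  assumes "rule_inst r P Q"
  shows "rule_inst r (sor P K) (sor Q K)"
proof -
  obtain K' where K: "K = cls K'"
    using ex_cls by blast
  have "sor (cls (fill S X)) K = cls (fill (OrC [] S [K']) X)" for S X
    by (simp add: K sor.abs_eq)
  then show ?thesis
    using rule_inst_fill[OF assms, of "\<lambda>P. sor P K"] by blast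
qed

lemma rule_inst_sand:
  assumes "rule_inst r P Q"
  shows "rule_inst r (sand P K) (sand Q K)"
proof -
  obtain K' where K: "K = cls K'"
    using ex_cls by blast
  have "sand (cls (fill S X)) K = cls (fill (AndC [] S [K']) X)" for S X
    by (simp add: K sand.abs_eq)
  then show ?thesis
    using rule_inst_fill[OF assms, of "\<lambda>P. sand P K"] by blast
qed

section \<open>Derivability as a relation compatible with both connectives\<close>

lemma derivation_append:
  assumes "derivation Sys P D Q" "derivation Sys Q E R"
  shows "derivation Sys P (D @ E) R"
  using assms by (induction rule: derivation.induct) (auto intro: derivation.intros)

lemma derivation_mono:
  assumes "derivation Sys P D Q" "Sys \<subseteq> Sys'"
  shows "derivation Sys' P D Q"
  using assms by (induction rule: derivation.induct) (auto intro: derivation.intros)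

definition derivable :: "rule set \<Rightarrow> 'a struct \<Rightarrow> 'a struct \<Rightarrow> bool" where
  "derivable Sys P Q \<longleftrightarrow> (\<exists>D. derivation Sys P D Q)"

lemma derivable_refl: "derivable Sys P P"
  unfolding derivable_def by (blast intro: derivation.single)

lemma derivable_trans [trans]:
  "derivable Sys P Q \<Longrightarrow> derivable Sys Q R \<Longrightarrow> derivable Sys P R"
  unfolding derivable_def by (blast intro: derivation_append)

lemma derivable_rule: "r \<in> Sys \<Longrightarrow> rule_inst r P Q \<Longrightarrow> derivable Sys P Q"
  unfolding derivable_def by (blast intro: derivation.intros)

lemma derivable_sor:
  assumes "derivable Sys P Q"
  shows "derivable Sys (sor P K) (sor Q K)"
proof -
  obtain D where "derivation Sys P D Q"
    using assms derivable_def by blast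
  then show ?thesis
  proof induction
    case (single T)
    show ?case by (rule derivable_refl)
  next
    case (step r T Q D R)
    then show ?case
      using derivable_trans derivable_rule rule_inst_sor by metis
  qed
qed

lemma derivable_sand:
  assumes "derivable Sys P Q"
  shows "derivable Sys (sand P K) (sand Q K)"
proof -
  obtain D where "derivation Sys P D Q"
    using assms derivable_def by blast
  then show ?thesis
  proof induction
    case (single T)
    show ?case by (rule derivable_refl)
  next
    case (step r T Q D R)
    then show ?case
      using derivable_trans derivable_rule rule_inst_sand by metis
  qed
qed

section \<open>Simulation of identity and cut by switch\<close>

lemma derivable_switch:
  assumes "Switch \<in> Sys"
  shows "derivable Sys (sand (sor X Y) Z) (sor (sand X Z) Y)"
proof -
  obtain x y z where "X = cls x" "Y = cls y" "Z = cls z"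
    using ex_cls by metis
  then show ?thesis
    using derivable_rule[OF assms rule_inst.s[of Hole x y z]] by (simp add: sor.abs_eq sand.abs_eq)
qed

text \<open>The conjunct \<open>T\<close> sinks to the hole layer by layer: a disjunctive layer
  costs one switch, a conjunctive one only associativity and commutativity.\<close>

lemma derivable_sand_into_fill:
  assumes "Switch \<in> Sys"
  shows "derivable Sys (sand (cls (fill S R)) (cls T)) (cls (fill S (And R [T])))"
proof (induction S)
  case Hole
  then show ?case
    by (simp add: sand.abs_eq derivable_refl)
next
  case (OrC Rs S Us)
  obtain W where W: "\<And>X. cls (or_list Rs X Us) = sor (cls X) W"
    using cls_or_list_eq_sor by metis
  then show ?case
    using derivable_trans[OF derivable_switch[OF assms] derivable_sor[OF OrC.IH]] by simp
next
  case (AndC Rs S Us)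
  obtain W where W: "\<And>X. cls (and_list Rs X Us) = sand (cls X) W"
    using cls_and_list_eq_sand by metis
  have "sand (sand (cls (fill S R)) W) (cls T) = sand (sand (cls (fill S R)) (cls T)) W"
    by (metis sand_assoc sand_commute)
  then show ?case
    using derivable_sand[OF AndC.IH, of W] by (simp add: W)
qed

text \<open>Dually, the disjunct \<open>T\<close> rises from the hole: here the conjunctive layers
  cost a switch and the disjunctive ones are free.\<close>

lemma derivable_sor_out_of_fill:
  assumes "Switch \<in> Sys"
  shows "derivable Sys (cls (fill S (Or R [T]))) (sor (cls (fill S R)) (cls T))"
proof (induction S)
  case Hole
  then show ?case
    by (simp add: sor.abs_eq derivable_refl)
next
  case (OrC Rs S Us)
  obtain W where W: "\<And>X. cls (or_list Rs X Us) = sor (cls X) W"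
    using cls_or_list_eq_sor by metis
  have "sor (sor (cls (fill S R)) W) (cls T) = sor (sor (cls (fill S R)) (cls T)) W"
    by (metis sor_assoc sor_commute)
  then show ?case
    using derivable_sor[OF OrC.IH, of W] by (simp add: W)
next
  case (AndC Rs S Us)
  obtain W where W: "\<And>X. cls (and_list Rs X Us) = sand (cls X) W"
    using cls_and_list_eq_sand by metis
  then show ?case
    using derivable_trans[OF derivable_sand[OF AndC.IH] derivable_switch[OF assms]] by simp
qed

lemma derivable_ai_down_factor:
  assumes "rule_inst Ai_down P Q" "Switch \<in> Sys"
  obtains I where "rule_inst Ai_down (cls TT) I" "derivable Sys (sand P I) Q"
  using assms(1)
proof cases
  case (ai_down a S)
  let ?I = "Or a [Neg a]"
  have "struct_eq (fill S (And TT [?I])) (fill S ?I)"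
    by (intro ctx_cong and_TT)
  then have "cls (fill S (And TT [?I])) = Q"
    by (simp add: ai_down(2) struct.abs_eq_iff)
  then have "derivable Sys (sand P (cls ?I)) Q"
    using derivable_sand_into_fill[OF assms(2), of S TT ?I] ai_down(1) by simp
  moreover have "rule_inst Ai_down (cls TT) (cls ?I)"
    using rule_inst.ai_down[OF ai_down(3), of Hole] by simp
  ultimately show ?thesis
    using that by blast
qed

lemma derivable_ai_up_factor:
  assumes "rule_inst Ai_up P Q" "Switch \<in> Sys"
  obtains I where "rule_inst Ai_up I (cls FF)" "derivable Sys P (sor Q I)"
  using assms(1)
proof cases
  case (ai_up a S)
  let ?I = "And a [Neg a]"
  \<comment> \<open>The hole of the conclusion contains false, neutral for disjunction, so the cut
    formula can be read as a disjunct that is free to rise.\<close>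
  have "struct_eq (fill S (Or FF [?I])) (fill S ?I)"
    by (intro ctx_cong or_FF)
  then have "cls (fill S (Or FF [?I])) = P"
    by (simp add: ai_up(1) struct.abs_eq_iff)
  then have "derivable Sys P (sor Q (cls ?I))"
    using derivable_sor_out_of_fill[OF assms(2), of S FF ?I] ai_up(2) by simp
  moreover have "rule_inst Ai_up (cls ?I) (cls FF)"
    using rule_inst.ai_up[OF ai_up(3), of Hole] by simp
  ultimately show ?thesis
    using that by blast
qed

text \<open>Induction from the top: the first instance is split off and the rest is already factored
  with some \<open>K\<close> and \<open>L\<close>. An identity adds a conjunct to \<open>K\<close>,
  a cut adds a disjunct to \<open>L\<close>, and any other rule is applied beside
  \<open>K\<close>.\<close>

lemma derivation_SKS_factor:
  assumes "derivation SKS T D R"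
  shows "\<exists>K L. derivable {Ai_down} (cls TT) K \<and> derivable {Ai_up} L (cls FF) \<and>
           derivable (SKS - {Ai_down, Ai_up}) (sand T K) (sor R L)"
  using assms
proof induction
  case (single T)
  have "derivable (SKS - {Ai_down, Ai_up}) (sand T (cls TT)) (sor T (cls FF))"
    by (simp add: derivable_refl)
  then show ?case
    using derivable_refl by blast
next
  case (step r T Q D R)
  let ?M = "SKS - {Ai_down, Ai_up}"
  have sw: "Switch \<in> ?M"
    by (simp add: SKS_def)
  obtain K L where K: "derivable {Ai_down} (cls TT) K" and L: "derivable {Ai_up} L (cls FF)"
    and M: "derivable ?M (sand Q K) (sor R L)"
    using step.IH by blast
  consider "r = Ai_down" | "r = Ai_up" | "r \<in> ?M"
    using step.hyps(1) by blast
  then show ?case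
  proof cases
    case 1
    then obtain I where I: "rule_inst Ai_down (cls TT) I" "derivable ?M (sand T I) Q"
      using derivable_ai_down_factor[OF _ sw] step.hyps(2) by blast
    have "derivable {Ai_down} (cls TT) I"
      using I(1) by (simp add: derivable_rule)
    \<comment> \<open>First true becomes \<open>K\<close>, which equals
      \<open>sand (cls TT) K\<close>; then this true becomes \<open>I\<close>.\<close>
    then have "derivable {Ai_down} (cls TT) (sand I K)"
      using derivable_trans[OF K] derivable_sand[of _ "cls TT" I K] by simp
    moreover have "derivable ?M (sand T (sand I K)) (sor R L)"
      using derivable_trans[OF derivable_sand[OF I(2)] M] by (simp add: sand_assoc)
    ultimately show ?thesis
      using L by blast
  next
    case 2
    then obtain I where I: "rule_inst Ai_up I (cls FF)" "derivable ?M T (sor Q I)"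
      using derivable_ai_up_factor[OF _ sw] step.hyps(2) by blast
    have "derivable {Ai_up} I (cls FF)"
      using I(1) by (simp add: derivable_rule)
    \<comment> \<open>\<open>L\<close> is reduced to false first, which leaves
      \<open>I\<close>.\<close>
    then have "derivable {Ai_up} (sor L I) (cls FF)"
      using derivable_trans[OF derivable_sor[OF L, of I]] by simp
    moreover have "derivable ?M (sand T K) (sor R (sor L I))"
    proof -
      have "derivable ?M (sand T K) (sand (sor Q I) K)"
        using I(2) by (rule derivable_sand)
      \<comment> \<open>The postponed cut formula \<open>I\<close> has to leave the conjunction with
        \<open>K\<close> before the remaining derivation can start from
        \<open>sand Q K\<close>.\<close>
      also have "derivable ?M (sand (sor Q I) K) (sor (sand Q K) I)"
        using sw by (rule derivable_switch)
      also have "derivable ?M (sor (sand Q K) I) (sor (sor R L) I)"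
        using M by (rule derivable_sor)
      finally show ?thesis
        by (simp add: sor_assoc)
    qed
    ultimately show ?thesis
      using K by blast
  next
    case 3
    then have "derivable ?M (sand T K) (sor R L)"
      using derivable_trans[OF derivable_sand[OF derivable_rule[OF _ step.hyps(2)]] M] by simp
    then show ?thesis
      using K L by blast
  qed
qed

theorem theorem3p31:
  fixes T R :: "'a struct" and D :: "(rule \<times> 'a struct) list"
  assumes "derivation SKS T D R"
  shows "\<exists>V U D1 D2 D3.
           derivation {Ai_down} T D1 V \<and>
           derivation (SKS - {Ai_down, Ai_up}) V D2 U \<and>
           derivation {Ai_up} U D3 R \<and>
           derivation SKS T (D1 @ D2 @ D3) R"
proof -
  obtain K L where K: "derivable {Ai_down} (cls TT) K" and L: "derivable {Ai_up} L (cls FF)"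
    and M: "derivable (SKS - {Ai_down, Ai_up}) (sand T K) (sor R L)"
    using derivation_SKS_factor[OF assms] by blast
  \<comment> \<open>All identities are created at once beside \<open>T\<close>, which equals
    \<open>sand (cls TT) T\<close>; the cuts below are removed dually beside
    \<open>R\<close>.\<close>
  have "derivable {Ai_down} T (sand T K)"
    using derivable_sand[OF K, of T] by (simp add: sand_commute)
  moreover have "derivable {Ai_up} (sor R L) R"
    using derivable_sor[OF L, of R] by (simp add: sor_commute)
  ultimately obtain D1 D2 D3 where D: "derivation {Ai_down} T D1 (sand T K)"
    "derivation (SKS - {Ai_down, Ai_up}) (sand T K) D2 (sor R L)"
    "derivation {Ai_up} (sor R L) D3 R"
    using M unfolding derivable_def by blast
  have "derivation SKS T (D1 @ D2 @ D3) R"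
    using D by (intro derivation_append) (erule derivation_mono, simp add: SKS_def; fail)+
  with D show ?thesis
    by blast
qed

end
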